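(* Let $\alpha\in(0,1)$, let $(L_i)_{i\in\mathbb N}$ be lags and put $\mathcal X_i=\{i-1,\dots,i-L_i\}$ for $i\in\mathbb N$. Let $(\gamma_i)_{i\in\mathbb N}$ be a non-negative, non-increasing sequence that sums to $1$, and let $\tau_i\in(0,1]$ and $\lambda_i\in[0,\tau_i)$ be $\mathcal G_{-\mathcal X_i}$-measurable, $i\in\mathbb N$. Then there exists a choice of weights $(g^*_{j,i})_{j\in\mathbb N,\,i>j}$, admissible for the $\text{ADDIS-Graph}_{\text{conf}}$ with conflict sets $(\mathcal X_i)_{i\in\mathbb N}$, such that the resulting $\text{ADDIS-Graph}_{\text{conf}}$ (with the same $\alpha$, $(\gamma_i)$, $(\tau_i)$, $(\lambda_i)$) uniformly improves the $\text{ADDIS-Spending}_{\text{local}}$, i.e. its levels satisfy $\alpha_i\ge\alpha_i^{\mathrm{spend}}$ for all $i\in\mathbb N$.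
   Context: $(P_i)_{i\in\mathbb N}$ are p-values in $[0,1]$. Lags are integers $L_i\in\{0,\dots,i-1\}$ with $L_{i+1}\le L_i+1$ for all $i$; they describe local dependence, i.e. $P_i$ is independent of $(P_1,\dots,P_{i-L_i-1})$. Write $\mathcal G_{-\mathcal X_i}=\sigma(\{P_j:j<i,\ j\notin\mathcal X_i\})=\sigma(P_1,\dots,P_{i-L_i-1})$, $S_i=\mathbf 1\{P_i\le\tau_i\}$, $C_i=\mathbf 1\{P_i\le\lambda_i\}$. $\text{ADDIS-Spending}_{\text{local}}$: tests $H_i$ at level $$\alpha_i^{\mathrm{spend}}=\alpha(\tau_i-\lambda_i)\gamma_{t(i)^{\mathrm{loc}}},\qquad t(i)^{\mathrm{loc}}=1+L_i+\sum_{j=1}^{i-L_i-1}(S_j-C_j).$$ $\text{ADDIS-Graph}_{\text{conf}}$: weights $(g^*_{j,i})_{j\in\mathbb N,i>j}$ are admissible if they are non-negative (possibly random), $g^*_{j,i}$ is $\mathcal G_{-\mathcal X_i}$-measurable, $g^*_{j,i}=0$ whenever $j\in\mathcal X_i$, and $\sum_{i>j,\,j\notin\mathcal X_i}g^*_{j,i}\le1$ for all $j$. The procedure tests $H_i$ at level $$\alpha_i=(\tau_i-\lambda_i)\left(\alpha\gamma_i+\sum_{j=1}^{i-1}g^*_{j,i}(C_j-S_j+1)\frac{\alpha_j}{\tau_j-\lambda_j}\right).$$ *)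

theory Defs
  imports "HOL-Probability.Probability"
begin

(* Hypotheses are numbered 1, 2, 3, ...; the value of any sequence at index 0 is irrelevant. *)

definition lags :: "(nat \<Rightarrow> nat) \<Rightarrow> bool" where
  "lags L \<longleftrightarrow> (\<forall>i\<ge>1. L i \<in> {0..i - 1} \<and> L (i + 1) \<le> L i + 1)"

(* The truncated subtraction is exact, since L i < i whenever L are lags. *)
definition lag_conflicts :: "(nat \<Rightarrow> nat) \<Rightarrow> nat \<Rightarrow> nat set" where
  "lag_conflicts L i = {i - L i..i - 1}"

(* The sigma-algebra generated by the P j with j < i and j outside the conflict set X i. *)
definition non_conflict_algebra ::
  "'a measure \<Rightarrow> (nat \<Rightarrow> 'a \<Rightarrow> real) \<Rightarrow> (nat \<Rightarrow> nat set) \<Rightarrow> nat \<Rightarrow> 'a measure" where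
  "non_conflict_algebra M P X i =
     sigma (space M) (\<Union>j\<in>{1..<i} - X i. {P j -` A \<inter> space M | A. A \<in> sets borel})"

(* For i \<ge> 1 and lags L, lag_conflicts L i = {i - L i..i - 1}, so the second sigma-algebra is the one
   generated by P 1, ..., P (i - L i - 1). *)
definition locally_dependent ::
  "'a measure \<Rightarrow> (nat \<Rightarrow> 'a \<Rightarrow> real) \<Rightarrow> (nat \<Rightarrow> nat) \<Rightarrow> bool" where
  "locally_dependent M P L \<longleftrightarrow>
     (\<forall>i\<ge>1. prob_space.indep_set M
        {P i -` A \<inter> space M | A. A \<in> sets borel}
        (sets (non_conflict_algebra M P (lag_conflicts L) i)))"

(* Used with T = \<tau> (the indicators S) and T = \<lambda> (the indicators C). *)
definition below_ind ::
  "(nat \<Rightarrow> 'a \<Rightarrow> real) \<Rightarrow> (nat \<Rightarrow> 'a \<Rightarrow> real) \<Rightarrow> nat \<Rightarrow> 'a \<Rightarrow> int" where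
  "below_ind P T i \<omega> = of_bool (P i \<omega> \<le> T i \<omega>)"

(* The sum is formed in int, so no truncation takes place in it; the conversion to nat
   is exact because \<lambda> < \<tau> makes every summand nonnegative. *)
definition spending_index ::
  "(nat \<Rightarrow> 'a \<Rightarrow> real) \<Rightarrow> (nat \<Rightarrow> nat) \<Rightarrow> (nat \<Rightarrow> 'a \<Rightarrow> real) \<Rightarrow> (nat \<Rightarrow> 'a \<Rightarrow> real)
     \<Rightarrow> nat \<Rightarrow> 'a \<Rightarrow> nat" where
  "spending_index P L \<tau> lam i \<omega> =
     nat (1 + int (L i) + (\<Sum>j = 1..i - L i - 1. below_ind P \<tau> j \<omega> - below_ind P lam j \<omega>))"

definition addis_spending_level ::
  "(nat \<Rightarrow> 'a \<Rightarrow> real) \<Rightarrow> real \<Rightarrow> (nat \<Rightarrow> real) \<Rightarrow> (nat \<Rightarrow> nat)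
     \<Rightarrow> (nat \<Rightarrow> 'a \<Rightarrow> real) \<Rightarrow> (nat \<Rightarrow> 'a \<Rightarrow> real) \<Rightarrow> nat \<Rightarrow> 'a \<Rightarrow> real" where
  "addis_spending_level P \<alpha> \<gamma> L \<tau> lam i \<omega> =
     \<alpha> * (\<tau> i \<omega> - lam i \<omega>) * \<gamma> (spending_index P L \<tau> lam i \<omega>)"

(* g j i is the random weight passed from hypothesis j to hypothesis i. *)
definition admissible_weights ::
  "'a measure \<Rightarrow> (nat \<Rightarrow> 'a \<Rightarrow> real) \<Rightarrow> (nat \<Rightarrow> nat set) \<Rightarrow> (nat \<Rightarrow> nat \<Rightarrow> 'a \<Rightarrow> real) \<Rightarrow> bool" where
  "admissible_weights M P X g \<longleftrightarrow>
     (\<forall>j\<ge>1. \<forall>i>j. (\<forall>\<omega>\<in>space M. 0 \<le> g j i \<omega>)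
        \<and> g j i \<in> borel_measurable (non_conflict_algebra M P X i)
        \<and> (j \<in> X i \<longrightarrow> (\<forall>\<omega>\<in>space M. g j i \<omega> = 0)))
     \<and> (\<forall>j\<ge>1. \<forall>\<omega>\<in>space M.
          (\<lambda>i. g j i \<omega>) summable_on {i. i > j \<and> j \<notin> X i}
          \<and> (\<Sum>\<^sub>\<infinity>i\<in>{i. i > j \<and> j \<notin> X i}. g j i \<omega>) \<le> 1)"

fun addis_graph_level ::
  "(nat \<Rightarrow> 'a \<Rightarrow> real) \<Rightarrow> real \<Rightarrow> (nat \<Rightarrow> real) \<Rightarrow> (nat \<Rightarrow> nat \<Rightarrow> 'a \<Rightarrow> real)
     \<Rightarrow> (nat \<Rightarrow> 'a \<Rightarrow> real) \<Rightarrow> (nat \<Rightarrow> 'a \<Rightarrow> real) \<Rightarrow> nat \<Rightarrow> 'a \<Rightarrow> real" where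
  "addis_graph_level P \<alpha> \<gamma> g \<tau> lam i \<omega> =
     (\<tau> i \<omega> - lam i \<omega>) *
     (\<alpha> * \<gamma> i +
      (\<Sum>j\<in>{1..<i}. g j i \<omega> * real_of_int (below_ind P lam j \<omega> - below_ind P \<tau> j \<omega> + 1)
          * (addis_graph_level P \<alpha> \<gamma> g \<tau> lam j \<omega> / (\<tau> j \<omega> - lam j \<omega>))))"

declare addis_graph_level.simps [simp del]

end

theory Submission
  imports Defs
begin

text \<open>
  Fix an outcome and call hypothesis \<open>j\<close> lost if \<open>P j \<le> lam j\<close> or \<open>P j > \<tau> j\<close>; at time \<open>i\<close> only the
  hypotheses \<open>1, \<dots>, n i\<close> with \<open>n i = i - L i - 1\<close> are known to be lost or not. The spending index
  \<open>t i\<close> is the number of hypotheses up to \<open>i\<close> that are not known to be lost at time \<open>i\<close>. If the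
  graph procedure has matched the spending levels before \<open>i\<close>, then the budget of the known losses
  that has not been passed on yet is the initial budget of the hypotheses before \<open>i\<close> minus the
  levels of those among them that are not known to be lost. Since \<open>t\<close> evaluated at the
  \<open>p\<close>-th hypothesis not known to be lost is at least \<open>p\<close>, the monotonicity of \<open>\<gamma>\<close> shows that this
  pool is at least \<open>\<gamma> (t i) - \<gamma> i\<close>. So hypothesis \<open>i\<close> can take the missing amount out of the pool,
  and taking the same fraction from every contributor gives weights that depend on the known
  losses only.
\<close>

text \<open>An element of rank \<open>p\<close> in \<open>A\<close> has \<open>t a\<close> at least
  \<open>p\<close>, hence contributes at most \<open>f p\<close>. The induction removes the maximum,
  whose rank is \<open>card A\<close>.\<close>

lemma sum_antimono_rank_le:
  fixes f :: "nat \<Rightarrow> real" and t :: "'b::linorder \<Rightarrow> nat"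
  assumes "finite A" and "antimono_on {1..} f"
    and "\<And>a. a \<in> A \<Longrightarrow> card (A \<inter> {..a}) \<le> t a"
  shows "(\<Sum>a\<in>A. f (t a)) \<le> (\<Sum>p=1..card A. f p)"
  using assms(1,3)
proof (induction A rule: finite_linorder_max_induct)
  case empty
  then show ?case by simp
next
  case (insert b A)
  have b: "b \<notin> A" using insert.hyps(2) by auto
  have "insert b A \<inter> {..b} = insert b A" using insert.hyps(2) by auto
  then have "Suc (card A) \<le> t b"
    using insert.prems[of b] insert.hyps(1) b by simp
  then have top: "f (t b) \<le> f (Suc (card A))"
    using assms(2) by (auto simp: monotone_on_def)
  have "card (A \<inter> {..a}) \<le> t a" if "a \<in> A" for a
  proof -
    have "insert b A \<inter> {..a} = A \<inter> {..a}" using insert.hyps(2) that by auto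
    then show ?thesis using insert.prems[of a] that by simp
  qed
  then have "(\<Sum>a\<in>A. f (t a)) \<le> (\<Sum>p=1..card A. f p)" by (rule insert.IH)
  then show ?case using top insert.hyps(1) b by simp
qed

text \<open>
  \<open>n i\<close> is the last hypothesis that does not conflict with \<open>i\<close>; \<open>D\<close> is the set of lost hypotheses.
\<close>

locale budget_recycling =
  fixes \<gamma> :: "nat \<Rightarrow> real" and n :: "nat \<Rightarrow> nat"
  assumes n_mono: "mono n" and n_le: "n i \<le> i - 1"
    and \<gamma>_nonneg: "i \<ge> 1 \<Longrightarrow> 0 \<le> \<gamma> i" and \<gamma>_antimono: "antimono_on {1..} \<gamma>"
begin

section \<open>Budget recycling along one fixed outcome\<close>

definition active :: "nat set \<Rightarrow> nat \<Rightarrow> nat set" where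
  "active D i = {1..i} - D \<inter> {1..n i}"

definition index :: "nat set \<Rightarrow> nat \<Rightarrow> nat" where
  "index D i = card (active D i)"

text \<open>Levels are in units of \<open>\<alpha> * (\<tau> l \<omega> - lam l \<omega>)\<close>.
  The formula avoids the weights, so that \<open>share\<close> and then the weights can be defined
  from it; \<open>pool_eq\<close> recovers its meaning.\<close>

definition pool :: "nat set \<Rightarrow> nat \<Rightarrow> real" where
  "pool D i = (\<Sum>l\<in>{1..<i}. \<gamma> l - \<gamma> (index D l)) + (\<Sum>l\<in>D \<inter> {1..n i}. \<gamma> (index D l))"

text \<open>An empty pool gives \<open>0 / 0 = 0\<close>, which is the right value: nothing is missing then.\<close>

definition share :: "nat set \<Rightarrow> nat \<Rightarrow> real" where
  "share D i = (\<gamma> (index D i) - \<gamma> i) / pool D i"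

text \<open>The fraction of the budget of \<open>j\<close> not yet passed on before time
  \<open>i\<close>; nothing is taken from \<open>j\<close> while its loss cannot be known.\<close>

definition remaining :: "nat set \<Rightarrow> nat \<Rightarrow> nat \<Rightarrow> real" where
  "remaining D j i = (\<Prod>k<i. if j \<le> n k then 1 - share D k else 1)"

definition weight :: "nat set \<Rightarrow> nat \<Rightarrow> nat \<Rightarrow> real" where
  "weight D j i = (if j \<le> n i then share D i * remaining D j i else 0)"

lemma active_local:
  assumes "l \<le> i"
  shows "active (D \<inter> {1..n i}) l = active D l"
proof -
  have "n l \<le> n i" using n_mono assms by (simp add: monoD)
  then show ?thesis by (auto simp: active_def)
qed

text \<open>Only losses up to \<open>n k\<close> with \<open>k \<le> l\<close> enter, and
  \<open>n k \<le> n i\<close> by monotonicity. This makes the weights at time \<open>i\<close>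
  functions of the losses known then, hence measurable.\<close>

lemma share_local:
  assumes "l \<le> i"
  shows "share (D \<inter> {1..n i}) l = share D l"
proof -
  have *: "index (D \<inter> {1..n i}) k = index D k" if "k \<le> l" for k
    using that assms by (simp add: index_def active_local del: One_nat_def)
  have "n l \<le> n i" using n_mono assms by (simp add: monoD)
  then have "D \<inter> {1..n i} \<inter> {1..n l} = D \<inter> {1..n l}" by auto
  moreover have "k \<le> l" if "k \<le> n l" for k using that n_le[of l] by simp
  ultimately have "pool (D \<inter> {1..n i}) l = pool D l"
    unfolding pool_def by (auto intro!: arg_cong2[where f="(+)"] sum.cong simp: * simp del: One_nat_def)
  then show ?thesis by (simp add: share_def * del: One_nat_def)
qed

lemma weight_local: "weight (D \<inter> {1..n i}) j i = weight D j i"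
  by (auto simp: weight_def remaining_def share_local simp del: One_nat_def intro!: prod.cong)

lemma index_bounds:
  assumes "i \<ge> 1"
  shows "1 \<le> index D i" "index D i \<le> i"
proof -
  have "i \<in> active D i" using assms n_le[of i] by (auto simp: active_def)
  moreover have "finite (active D i)" by (simp add: active_def)
  ultimately show "1 \<le> index D i"
    by (metis One_nat_def Suc_leI card_gt_0_iff empty_iff index_def)
  have "card (active D i) \<le> card {1..i}" by (rule card_mono) (auto simp: active_def)
  then show "index D i \<le> i" by (simp add: index_def)
qed

lemma \<gamma>_index_ge: "i \<ge> 1 \<Longrightarrow> \<gamma> i \<le> \<gamma> (index D i)"
  using \<gamma>_antimono index_bounds[of i D] by (auto simp: monotone_on_def)

lemma missing_le_pool:
  assumes i: "i \<ge> 1"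
  shows "\<gamma> (index D i) - \<gamma> i \<le> pool D i"
proof -
  have fin: "finite (active D i)" by (simp add: active_def)
  have "(\<Sum>l\<in>active D i. \<gamma> (index D l)) \<le> (\<Sum>p=1..index D i. \<gamma> p)"
    unfolding index_def[of D i]
  proof (rule sum_antimono_rank_le[OF fin \<gamma>_antimono])
    fix l assume "l \<in> active D i"
    \<comment> \<open>What is known to be lost at time \<open>l\<close> is still known at time
      \<open>i\<close>, so the members of \<open>active D i\<close> up to \<open>l\<close> were all
      counted by \<open>index D l\<close>.\<close>
    then have "n l \<le> n i" using n_mono by (auto simp: active_def monoD)
    then have "active D i \<inter> {..l} \<subseteq> active D l" by (auto simp: active_def)
    then show "card (active D i \<inter> {..l}) \<le> index D l"
      unfolding index_def by (intro card_mono) (auto simp: active_def)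
  qed
  also have "\<dots> \<le> (\<Sum>p=1..i. \<gamma> p)"
    using index_bounds(2)[OF i, of D] \<gamma>_nonneg by (intro sum_mono2) auto
  finally have le: "(\<Sum>l\<in>active D i. \<gamma> (index D l)) \<le> (\<Sum>p=1..i. \<gamma> p)" .
  have sub: "D \<inter> {1..n i} \<subseteq> {1..i}" using n_le[of i] by auto
  have *: "{1..i} = insert i {1..<i}" using i by auto
  have "(\<Sum>l\<in>active D i. \<gamma> (index D l))
      = (\<Sum>l\<in>{1..i}. \<gamma> (index D l)) - (\<Sum>l\<in>D \<inter> {1..n i}. \<gamma> (index D l))"
    unfolding active_def by (rule sum_diff[OF _ sub]) simp
  then show ?thesis
    using le unfolding * by (simp add: pool_def sum_subtractf)
qed

lemma share_bounds:
  assumes "i \<ge> 1"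
  shows "0 \<le> share D i" "share D i \<le> 1" "share D i * pool D i = \<gamma> (index D i) - \<gamma> i"
proof -
  have *: "0 \<le> \<gamma> (index D i) - \<gamma> i" "\<gamma> (index D i) - \<gamma> i \<le> pool D i"
    using \<gamma>_index_ge[OF assms, of D] missing_le_pool[OF assms, of D] by simp_all
  then show "0 \<le> share D i" "share D i \<le> 1"
    unfolding share_def by (auto simp: divide_le_eq_1)
  show "share D i * pool D i = \<gamma> (index D i) - \<gamma> i"
    using * by (cases "pool D i = 0") (simp_all add: share_def)
qed

lemma remaining_bounds:
  assumes "j \<ge> 1"
  shows "0 \<le> remaining D j i" "remaining D j i \<le> 1"
proof -
  \<comment> \<open>Time 0, where \<open>share_bounds\<close> says nothing, contributes a factor 1
    because \<open>n 0 = 0\<close>.\<close>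
  have "k \<ge> 1" if "j \<le> n k" for k using that assms n_le[of k] by linarith
  then show "0 \<le> remaining D j i" "remaining D j i \<le> 1"
    unfolding remaining_def by (auto intro!: prod_nonneg prod_le_1 simp: share_bounds)
qed

lemma weight_nonneg:
  assumes "j \<ge> 1"
  shows "0 \<le> weight D j i"
proof -
  have "i \<ge> 1" if "j \<le> n i" using that assms n_le[of i] by linarith
  then show ?thesis
    using share_bounds(1) remaining_bounds(1)[OF assms] by (auto simp: weight_def)
qed

text \<open>Each weight equals \<open>remaining D j i - remaining D j (Suc i)\<close>, so the sum
  telescopes from \<open>remaining D j 0 = 1\<close>.\<close>

lemma sum_weight: "(\<Sum>i<m. weight D j i) = 1 - remaining D j m"
proof (induction m)
  case 0
  then show ?case by (simp add: remaining_def)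
next
  case (Suc m)
  have "remaining D j (Suc m) = remaining D j m * (if j \<le> n m then 1 - share D m else 1)"
    by (simp add: remaining_def)
  then show ?case using Suc.IH by (simp add: weight_def algebra_simps)
qed

lemma weight_summable:
  assumes "j \<ge> 1"
  shows "weight D j summable_on I" "infsum (weight D j) I \<le> 1"
proof -
  have fin: "sum (weight D j) F \<le> 1" if F: "finite F" for F
  proof -
    obtain m where "F \<subseteq> {..<m}" using finite_nat_bounded[OF F] by blast
    then have "sum (weight D j) F \<le> (\<Sum>i<m. weight D j i)"
      by (intro sum_mono2) (auto intro: weight_nonneg[OF assms])
    then show ?thesis using remaining_bounds(1)[OF assms, of D m] by (simp add: sum_weight)
  qed
  show "weight D j summable_on I"
    by (rule nonneg_bdd_above_summable_on)
      (auto intro!: bdd_aboveI[where M=1] fin weight_nonneg[OF assms])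
  then show "infsum (weight D j) I \<le> 1"
    by (rule infsum_le_finite_sums) (rule fin)
qed

text \<open>Both sides change alike from \<open>i\<close> to \<open>i + 1\<close>: the old
  contributors together give up \<open>share D i * pool D i\<close>, the amount missing at
  \<open>i\<close>, and the newly known losses join with untouched budgets.\<close>

lemma pool_eq: "pool D i = (\<Sum>j\<in>D \<inter> {1..n i}. remaining D j i * \<gamma> (index D j))"
proof (induction i)
  case 0
  have "n 0 = 0" using n_le[of 0] by simp
  then show ?case by (simp add: pool_def)
next
  case (Suc i)
  show ?case
  proof (cases "i = 0")
    case True
    have "n 1 = 0" using n_le[of 1] by simp
    then show ?thesis using True by (simp add: pool_def)
  next
    case False
    then have i: "i \<ge> 1" by simp
    define B where "B = D \<inter> {n i<..n (Suc i)}"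
    have "n i \<le> n (Suc i)" using n_mono by (simp add: monoD)
    then have split: "D \<inter> {1..n (Suc i)} = (D \<inter> {1..n i}) \<union> B"
      by (auto simp: B_def)
    have disj: "(D \<inter> {1..n i}) \<inter> B = {}" "finite B" by (auto simp: B_def)
    have union: "sum h (D \<inter> {1..n (Suc i)}) = sum h (D \<inter> {1..n i}) + sum h B"
      for h :: "nat \<Rightarrow> real"
      unfolding split by (rule sum.union_disjoint[OF _ disj(2,1)]) simp
    have old: "remaining D j (Suc i) = (1 - share D i) * remaining D j i" if "j \<le> n i" for j
      using that by (simp add: remaining_def)
    \<comment> \<open>For \<open>k \<le> i\<close> monotonicity gives
      \<open>n k \<le> n i < j\<close>, so every factor of the product is 1.\<close>
    have new: "remaining D j (Suc i) = 1" if "j \<in> B" for j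
    proof -
      have "\<not> j \<le> n k" if "k < Suc i" for k
        using monoD[OF n_mono, of k i] that \<open>j \<in> B\<close> by (auto simp: B_def)
      then show ?thesis by (simp add: remaining_def)
    qed
    have "(\<Sum>j\<in>D \<inter> {1..n (Suc i)}. remaining D j (Suc i) * \<gamma> (index D j))
        = (\<Sum>j\<in>D \<inter> {1..n i}. (1 - share D i) * (remaining D j i * \<gamma> (index D j)))
          + (\<Sum>j\<in>B. \<gamma> (index D j))"
      unfolding union by (auto simp: old new mult.assoc intro!: arg_cong2[where f="(+)"] sum.cong)
    also have "\<dots> = (1 - share D i) * pool D i + (\<Sum>j\<in>B. \<gamma> (index D j))"
      by (simp only: Suc.IH sum_distrib_left)
    also have "\<dots> = pool D i - share D i * pool D i + (\<Sum>j\<in>B. \<gamma> (index D j))"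
      by (simp add: left_diff_distrib)
    also have "\<dots> = pool D i + (\<gamma> i - \<gamma> (index D i)) + (\<Sum>j\<in>B. \<gamma> (index D j))"
      by (simp add: share_bounds(3)[OF i])
    also have "\<dots> = pool D (Suc i)"
    proof -
      have "{1..<Suc i} = insert i {1..<i}" using i by auto
      then show ?thesis unfolding pool_def union by simp
    qed
    finally show ?thesis by simp
  qed
qed

text \<open>The graph recursion in normalized levels: the recycled sum is
  \<open>share D i * pool D i\<close>, which is what \<open>\<gamma> i\<close> lacks.\<close>

lemma recycled_budget:
  assumes "i \<ge> 1"
  shows "\<gamma> i + (\<Sum>j\<in>{1..<i}. weight D j i * of_bool (j \<in> D) * \<gamma> (index D j)) = \<gamma> (index D i)"
proof -
  have "(\<Sum>j\<in>{1..<i}. weight D j i * of_bool (j \<in> D) * \<gamma> (index D j))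
      = (\<Sum>j\<in>D \<inter> {1..n i}. share D i * (remaining D j i * \<gamma> (index D j)))"
    using n_le[of i] assms
    by (intro sum.mono_neutral_cong_right) (auto simp: weight_def)
  also have "\<dots> = share D i * pool D i" by (simp add: pool_eq sum_distrib_left)
  finally show ?thesis by (simp add: share_bounds(3)[OF assms])
qed

end

section \<open>Lags, sigma-algebras and random sets\<close>

lemma lags_last_known:
  assumes "lags L"
  shows "mono (\<lambda>i. i - L i - 1)" "i \<ge> 1 \<Longrightarrow> L i < i"
    "i \<ge> 1 \<Longrightarrow> {1..<i} - lag_conflicts L i = {1..i - L i - 1}"
proof -
  have *: "L k < k \<and> L (Suc k) \<le> L k + 1" if "k \<ge> 1" for k
    using assms that by (force simp: lags_def)
  then show "i \<ge> 1 \<Longrightarrow> L i < i" by blast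
  then show "i \<ge> 1 \<Longrightarrow> {1..<i} - lag_conflicts L i = {1..i - L i - 1}"
    by (auto simp: lag_conflicts_def)
  \<comment> \<open>A lag grows by at most 1 per step, so the last known index never decreases.
    \<open>lags\<close> is silent at index 0, where truncated subtraction gives 0.\<close>
  show "mono (\<lambda>i. i - L i - 1)"
    unfolding mono_iff_le_Suc
  proof
    fix k
    show "k - L k - 1 \<le> Suc k - L (Suc k) - 1"
      using *[of k] by (cases "k = 0") auto
  qed
qed

lemma sets_non_conflict_algebra:
  "space (non_conflict_algebra M P X i) = space M"
  "sets (non_conflict_algebra M P X i) =
     sigma_sets (space M) (\<Union>j\<in>{1..<i} - X i. {P j -` A \<inter> space M | A. A \<in> sets borel})"
  unfolding non_conflict_algebra_def
  by (rule space_measure_of sets_measure_of; blast)+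

lemma non_conflict_algebra_mono:
  assumes "{1..<i} - X i \<subseteq> {1..<k} - X k"
  shows "borel_measurable (non_conflict_algebra M P X i)
    \<subseteq> borel_measurable (non_conflict_algebra M P X k)"
proof (rule measurable_mono)
  show "sets (non_conflict_algebra M P X i) \<subseteq> sets (non_conflict_algebra M P X k)"
    unfolding sets_non_conflict_algebra using assms by (intro sigma_sets_mono') blast
qed (simp_all add: sets_non_conflict_algebra)

lemma measurable_non_conflict:
  assumes "j \<in> {1..<i} - X i"
  shows "P j \<in> borel_measurable (non_conflict_algebra M P X i)"
proof (rule measurableI)
  fix A :: "real set" assume "A \<in> sets borel"
  then show "P j -` A \<inter> space (non_conflict_algebra M P X i) \<in> sets (non_conflict_algebra M P X i)"
    unfolding sets_non_conflict_algebra using assms by (intro sigma_sets.Basic) blast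
qed simp

text \<open>There are finitely many possible values \<open>B\<close>, and each event
  \<open>D \<omega> \<inter> F = B\<close> is a finite intersection of membership events and their
  complements.\<close>

lemma measurable_finite_random_set:
  assumes "finite F" and "\<And>j. j \<in> F \<Longrightarrow> {\<omega> \<in> space N. j \<in> D \<omega>} \<in> sets N"
  shows "(\<lambda>\<omega>. D \<omega> \<inter> F) \<in> measurable N (count_space (Pow F))"
proof (subst measurable_count_space_eq2[OF finite_Pow_iff[THEN iffD2, OF assms(1)]])
  have "(\<lambda>\<omega>. D \<omega> \<inter> F) -` {B} \<inter> space N \<in> sets N" if "B \<in> Pow F" for B
  proof -
    have "(\<lambda>\<omega>. D \<omega> \<inter> F) -` {B} \<inter> space N
        = {\<omega> \<in> space N. \<forall>j\<in>F. j \<in> D \<omega> \<longleftrightarrow> j \<in> B}"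
      using that by auto
    also have "\<dots> \<in> sets N"
    proof (rule sets.sets_Collect_finite_All[OF _ assms(1)])
      fix j assume "j \<in> F"
      from assms(2)[OF this] show "{\<omega> \<in> space N. j \<in> D \<omega> \<longleftrightarrow> j \<in> B} \<in> sets N"
        by (cases "j \<in> B") (auto intro: sets.sets_Collect_neg)
    qed
    finally show ?thesis .
  qed
  then show "(\<lambda>\<omega>. D \<omega> \<inter> F) \<in> space N \<rightarrow> Pow F \<and>
      (\<forall>a\<in>Pow F. (\<lambda>\<omega>. D \<omega> \<inter> F) -` {a} \<inter> space N \<in> sets N)"
    by auto
qed

theorem proposition5p2:
  fixes M :: "'a measure"
    and P :: "nat \<Rightarrow> 'a \<Rightarrow> real"
    and \<alpha> :: real
    and L :: "nat \<Rightarrow> nat"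
    and \<gamma> :: "nat \<Rightarrow> real"
    and \<tau> lam :: "nat \<Rightarrow> 'a \<Rightarrow> real"
  assumes "prob_space M"
    and "\<And>i. i \<ge> 1 \<Longrightarrow> P i \<in> borel_measurable M"
    and "\<And>i \<omega>. i \<ge> 1 \<Longrightarrow> \<omega> \<in> space M \<Longrightarrow> P i \<omega> \<in> {0..1}"
    and "\<alpha> \<in> {0<..<1}"
    and "lags L"
    and "locally_dependent M P L"
    and "\<And>i. i \<ge> 1 \<Longrightarrow> 0 \<le> \<gamma> i"
    and "antimono_on {1..} \<gamma>"
    and "(\<gamma> has_sum 1) {1..}"
    and "\<And>i. i \<ge> 1 \<Longrightarrow> \<tau> i \<in> borel_measurable (non_conflict_algebra M P (lag_conflicts L) i)"
    and "\<And>i. i \<ge> 1 \<Longrightarrow> lam i \<in> borel_measurable (non_conflict_algebra M P (lag_conflicts L) i)"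
    and "\<And>i \<omega>. i \<ge> 1 \<Longrightarrow> \<omega> \<in> space M \<Longrightarrow> \<tau> i \<omega> \<in> {0<..1}"
    and "\<And>i \<omega>. i \<ge> 1 \<Longrightarrow> \<omega> \<in> space M \<Longrightarrow> lam i \<omega> \<in> {0..<\<tau> i \<omega>}"
  shows "\<exists>g :: nat \<Rightarrow> nat \<Rightarrow> 'a \<Rightarrow> real.
           admissible_weights M P (lag_conflicts L) g \<and>
           (\<forall>i\<ge>1. \<forall>\<omega>\<in>space M.
              addis_graph_level P \<alpha> \<gamma> g \<tau> lam i \<omega> \<ge> addis_spending_level P \<alpha> \<gamma> L \<tau> lam i \<omega>)"
proof -
  define n where "n = (\<lambda>i. i - L i - 1)"
  have n_mono: "mono n" unfolding n_def by (rule lags_last_known(1)[OF assms(5)])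
  interpret budget_recycling \<gamma> n
    using n_mono assms(7,8) by unfold_locales (auto simp: n_def)
  \<comment> \<open>As \<open>lam j \<omega> < \<tau> j \<omega>\<close>, membership means
    \<open>C - S + 1 = 1\<close> and non-membership means \<open>S - C = 1\<close>.\<close>
  define D where "D = (\<lambda>\<omega>. {j. P j \<omega> \<le> lam j \<omega> \<or> \<tau> j \<omega> < P j \<omega>})"
  define g where "g = (\<lambda>j i \<omega>. weight (D \<omega>) j i)"
  let ?N = "non_conflict_algebra M P (lag_conflicts L)"
  have known: "{1..<i} - lag_conflicts L i = {1..n i}" if "i \<ge> 1" for i
    using lags_last_known(3)[OF assms(5) that] by (simp add: n_def)

  have meas: "g j i \<in> borel_measurable (?N i)" if i: "i \<ge> 1" for j i
  proof -
    have "{\<omega> \<in> space (?N i). l \<in> D \<omega>} \<in> sets (?N i)" if l: "l \<in> {1..n i}" for l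
    proof -
      have l1: "l \<ge> 1" "l \<le> i" using l n_le[of i] by auto
      have "n l \<le> n i" using n_mono l1 by (simp add: monoD)
      \<comment> \<open>The thresholds of \<open>l\<close> are measurable for the algebra at
        \<open>l\<close>, which is contained in the one at \<open>i\<close>.\<close>
      then have "{1..<l} - lag_conflicts L l \<subseteq> {1..<i} - lag_conflicts L i"
        using known[OF i] known[OF l1(1)] by auto
      from non_conflict_algebra_mono[OF this] assms(10,11)[OF l1(1)]
      have [measurable]: "\<tau> l \<in> borel_measurable (?N i)" "lam l \<in> borel_measurable (?N i)"
        by auto
      have [measurable]: "P l \<in> borel_measurable (?N i)"
        by (rule measurable_non_conflict) (use known[OF i] l in simp)
      show ?thesis unfolding D_def mem_Collect_eq by measurable
    qed
    then have "(\<lambda>\<omega>. D \<omega> \<inter> {1..n i}) \<in> measurable (?N i) (count_space (Pow {1..n i}))"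
      by (intro measurable_finite_random_set) auto
    \<comment> \<open>Every function on a \<open>count_space\<close> is measurable, so the formula
      for the weight need not be examined.\<close>
    from measurable_compose[OF this, of "\<lambda>B. weight B j i" borel]
    show ?thesis by (simp add: g_def weight_local del: One_nat_def)
  qed

  have zero: "g j i \<omega> = 0" if "1 \<le> j" "j < i" "j \<in> lag_conflicts L i" for j i \<omega>
  proof -
    have "\<not> j \<le> n i" using that by (auto simp: lag_conflicts_def n_def)
    then show ?thesis by (simp add: g_def weight_def)
  qed
  have adm: "admissible_weights M P (lag_conflicts L) g"
    unfolding admissible_weights_def
  proof (intro conjI allI impI ballI)
    fix j i :: nat and \<omega> assume j: "1 \<le> j" and i: "j < i"
    show "0 \<le> g j i \<omega>" unfolding g_def using j by (rule weight_nonneg)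
    show "g j i \<in> borel_measurable (?N i)" using j i by (intro meas) simp
    show "g j i \<omega> = 0" if "j \<in> lag_conflicts L i" using j i that by (rule zero)
  next
    fix j :: nat and \<omega> assume j: "1 \<le> j"
    show "(\<lambda>i. g j i \<omega>) summable_on {i. j < i \<and> j \<notin> lag_conflicts L i}"
      "(\<Sum>\<^sub>\<infinity>i\<in>{i. j < i \<and> j \<notin> lag_conflicts L i}. g j i \<omega>) \<le> 1"
      unfolding g_def using weight_summable[OF j] by blast+
  qed

  have spend: "spending_index P L \<tau> lam i \<omega> = index (D \<omega>) i"
    if i: "i \<ge> 1" and \<omega>: "\<omega> \<in> space M" for i \<omega>
  proof -
    have U: "below_ind P \<tau> j \<omega> - below_ind P lam j \<omega> = of_bool (j \<notin> D \<omega>)" if "j \<ge> 1" for j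
      using assms(13)[OF that \<omega>] by (auto simp: below_ind_def D_def)
    have "(\<Sum>j = 1..n i. below_ind P \<tau> j \<omega> - below_ind P lam j \<omega>)
        = (\<Sum>j = 1..n i. of_bool (j \<notin> D \<omega>))"
      by (rule sum.cong) (simp_all add: U)
    also have "\<dots> = int (card ({1..n i} - D \<omega>))"
      by (simp add: sum_of_bool_eq Int_def set_diff_eq)
    finally have *: "(\<Sum>j = 1..n i. below_ind P \<tau> j \<omega> - below_ind P lam j \<omega>)
        = int (card ({1..n i} - D \<omega>))" .
    \<comment> \<open>The \<open>1 + L i\<close> indices after \<open>n i\<close>, namely
      \<open>i\<close> and its conflicts, always count as active; they are the summand
      \<open>1 + L i\<close> of the spending index.\<close>
    have "active (D \<omega>) i = ({1..n i} - D \<omega>) \<union> {n i<..i}"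
      using n_le[of i] by (auto simp: active_def)
    moreover have "card (({1..n i} - D \<omega>) \<union> {n i<..i}) = card ({1..n i} - D \<omega>) + (i - n i)"
      by (subst card_Un_disjoint) auto
    moreover have "i - n i = 1 + L i"
      using lags_last_known(2)[OF assms(5) i] by (simp add: n_def)
    ultimately have "int (index (D \<omega>) i) = 1 + int (L i) + int (card ({1..n i} - D \<omega>))"
      by (simp add: index_def)
    then show ?thesis
      unfolding spending_index_def using * by (simp add: n_def)
  qed

  have graph: "addis_graph_level P \<alpha> \<gamma> g \<tau> lam i \<omega>
      = \<alpha> * (\<tau> i \<omega> - lam i \<omega>) * \<gamma> (index (D \<omega>) i)"
    if "i \<ge> 1" and \<omega>: "\<omega> \<in> space M" for i \<omega>
    using that(1)
  proof (induction i rule: less_induct)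
    case (less i)
    \<comment> \<open>By induction the earlier level carries the factor
      \<open>\<tau> j \<omega> - lam j \<omega>\<close>, which is positive and cancels.\<close>
    have "g j i \<omega> * real_of_int (below_ind P lam j \<omega> - below_ind P \<tau> j \<omega> + 1)
          * (addis_graph_level P \<alpha> \<gamma> g \<tau> lam j \<omega> / (\<tau> j \<omega> - lam j \<omega>))
        = \<alpha> * (weight (D \<omega>) j i * of_bool (j \<in> D \<omega>) * \<gamma> (index (D \<omega>) j))"
      if j: "j \<in> {1..<i}" for j
    proof -
      have "j \<ge> 1" using j by simp
      from assms(13)[OF this \<omega>] less.IH[of j] j show ?thesis
        by (auto simp: below_ind_def D_def g_def)
    qed
    then have "addis_graph_level P \<alpha> \<gamma> g \<tau> lam i \<omega> = (\<tau> i \<omega> - lam i \<omega>) * (\<alpha> * (\<gamma> i +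
        (\<Sum>j\<in>{1..<i}. weight (D \<omega>) j i * of_bool (j \<in> D \<omega>) * \<gamma> (index (D \<omega>) j))))"
      by (subst addis_graph_level.simps) (simp add: sum_distrib_left distrib_left)
    then show ?case unfolding recycled_budget[OF less.prems] by simp
  qed
  \<comment> \<open>With these weights the two levels coincide, so the inequality holds with
    equality.\<close>
  show ?thesis
    using adm graph spend by (intro exI[of _ g]) (auto simp: addis_spending_level_def)
qed

end
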